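(* For every cubic polynomial $p\in\mathbb{C}[Z]$ there exist starting points $\underline z\in\mathbb{C}^3$ such that the iterates $W_p^{\circ n}(\underline z)$ are defined for all $n\ge0$ and each of the three coordinates of $W_p^{\circ n}(\underline z)$ tends to $\infty$ in absolute value as $n\to\infty$. The set of such escaping points contains a holomorphic curve.
   Context: For a monic polynomial $p\in\mathbb{C}[Z]$ of degree $d$, the Weierstrass map $W_p$ is the partially defined map $\mathbb{C}^d\setminus\Delta\to\mathbb{C}^d$, $\underline z\mapsto \underline z'$ with $z'_k=z_k-\dfrac{p(z_k)}{\prod_{j\ne k}(z_k-z_j)}$, where $\Delta=\{\underline z\in\mathbb{C}^d: z_j=z_k\text{ for some }j<k\}$. For non-monic $p$ with leading coefficient $c$, $W_p:=W_{p/c}$. *)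

theory Defs
  imports "HOL-Complex_Analysis.Complex_Analysis" "HOL-Computational_Algebra.Polynomial"
begin

definition off_diagonal :: "complex^'n \<Rightarrow> bool" where
  "off_diagonal z \<longleftrightarrow> (\<forall>j k. j \<noteq> k \<longrightarrow> z $ j \<noteq> z $ k)"

text \<open>Weierstrass map; for non-monic p we divide by the leading coefficient.
  It is only meaningful off the diagonal.\<close>

definition weierstrass_map :: "complex poly \<Rightarrow> complex^'n \<Rightarrow> complex^'n" where
  "weierstrass_map p z =
     (\<chi> k. z $ k - poly (smult (inverse (lead_coeff p)) p) (z $ k)
                   / (\<Prod>j\<in>UNIV - {k}. (z $ k - z $ j)))"

definition iterates_defined :: "complex poly \<Rightarrow> complex^'n \<Rightarrow> bool" where
  "iterates_defined p z \<longleftrightarrow> (\<forall>n. off_diagonal ((weierstrass_map p ^^ n) z))"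

definition escaping_set :: "complex poly \<Rightarrow> (complex^'n) set" where
  "escaping_set p = {z. iterates_defined p z \<and>
     (\<forall>k. filterlim (\<lambda>n. norm (((weierstrass_map p ^^ n) z) $ k)) at_top sequentially)}"

end

theory Submission
  imports Defs
begin

text \<open>
  After translating by the barycentre \<open>m\<close> of the roots, \<open>p\<close> becomes \<open>Z^3 + a Z - b\<close>, and the plane of
  points with barycentre \<open>m\<close> is invariant. Near infinity write such a point as
  \<open>m + (1/w) (1, (y-1)/2, (-y-1)/2)\<close>. At \<open>w = 0\<close>, where \<open>a\<close> and \<open>b\<close> disappear, the Weierstrass map
  acts on the shape parameter by \<open>y \<mapsto> (y^4 - 12 y^2 + 3) / (2 y (y^2 - 5))\<close>; composed with the
  transposition \<open>y \<mapsto> -y\<close> of the last two coordinates it fixes \<open>y^2 = (11 + 4 sqrt 7) / 3\<close>.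
  There the multiplier in the \<open>y\<close>-direction exceeds 1 in modulus, whereas \<open>w\<close> is multiplied by
  \<open>(9 - y^2) / (5 - y^2)\<close>, of modulus below 1. So the point at infinity is a saddle, and its stable
  manifold, the graph of a holomorphic function \<open>y = y(w)\<close>, consists of escaping points.
\<close>

subsection \<open>Strict derivatives\<close>

text \<open>Comparing two nearby points with each other, rather than one point with
  \<open>p\<close>, says that \<open>f - L\<close> is Lipschitz near \<open>p\<close> with
  arbitrarily small constant. This is the form in which the graph transform uses smoothness, and the
  algebraic rules below yield it for rational maps directly.\<close>

definition has_strict_derivative ::
  "('a::real_normed_vector \<Rightarrow> 'b::real_normed_vector) \<Rightarrow> ('a \<Rightarrow> 'b) \<Rightarrow> 'a \<Rightarrow> bool" where
  "has_strict_derivative f L p \<longleftrightarrow> bounded_linear L \<and>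
     (\<forall>e>0. \<forall>\<^sub>F z in nhds (p, p).
        norm (f (fst z) - f (snd z) - L (fst z - snd z)) \<le> e * norm (fst z - snd z))"

lemma has_strict_derivative_bounded_linear:
  "bounded_linear L \<Longrightarrow> has_strict_derivative L L p"
  by (simp add: has_strict_derivative_def linear_diff bounded_linear.linear)

lemma has_strict_derivative_const:
  "has_strict_derivative (\<lambda>x. c) (\<lambda>v. 0) p"
  by (simp add: has_strict_derivative_def)

lemma has_strict_derivative_add:
  assumes "has_strict_derivative f L p" "has_strict_derivative g M p"
  shows "has_strict_derivative (\<lambda>x. f x + g x) (\<lambda>v. L v + M v) p"
  unfolding has_strict_derivative_def
proof (intro conjI allI impI)
  show "bounded_linear (\<lambda>v. L v + M v)"
    using assms by (auto simp: has_strict_derivative_def intro: bounded_linear_add)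
  fix e :: real assume "e > 0"
  then have "e / 2 > 0" by simp
  with assms have
    "\<forall>\<^sub>F z in nhds (p, p). norm (f (fst z) - f (snd z) - L (fst z - snd z)) \<le> e / 2 * norm (fst z - snd z)"
    "\<forall>\<^sub>F z in nhds (p, p). norm (g (fst z) - g (snd z) - M (fst z - snd z)) \<le> e / 2 * norm (fst z - snd z)"
    unfolding has_strict_derivative_def by blast+
  then show "\<forall>\<^sub>F z in nhds (p, p). norm (f (fst z) + g (fst z) - (f (snd z) + g (snd z))
        - (L (fst z - snd z) + M (fst z - snd z))) \<le> e * norm (fst z - snd z)"
  proof eventually_elim
    case (elim z)
    have "norm (f (fst z) + g (fst z) - (f (snd z) + g (snd z)) - (L (fst z - snd z) + M (fst z - snd z)))
      = norm ((f (fst z) - f (snd z) - L (fst z - snd z)) + (g (fst z) - g (snd z) - M (fst z - snd z)))"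
      by (simp add: algebra_simps)
    also have "\<dots> \<le> e / 2 * norm (fst z - snd z) + e / 2 * norm (fst z - snd z)"
      using elim by (intro norm_triangle_le add_mono)
    finally show ?case by simp
  qed
qed

lemma has_strict_derivative_uminus:
  assumes "has_strict_derivative f L p"
  shows "has_strict_derivative (\<lambda>x. - f x) (\<lambda>v. - L v) p"
proof -
  have "norm (- a - - b - - c) = norm (a - b - c)" for a b c :: 'b
    by (metis minus_diff_minus norm_minus_cancel)
  then show ?thesis
    using assms by (simp add: has_strict_derivative_def bounded_linear_minus)
qed

lemma has_strict_derivative_diff:
  assumes "has_strict_derivative f L p" "has_strict_derivative g M p"
  shows "has_strict_derivative (\<lambda>x. f x - g x) (\<lambda>v. L v - M v) p"
  using has_strict_derivative_add[OF assms(1) has_strict_derivative_uminus[OF assms(2)]] by simp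

lemma has_strict_derivative_imp_isCont:
  assumes "has_strict_derivative f L p"
  shows "isCont f p"
proof -
  have L: "bounded_linear L"
    and ev: "\<forall>\<^sub>F z in nhds (p, p). norm (f (fst z) - f (snd z) - L (fst z - snd z)) \<le> 1 * norm (fst z - snd z)"
    using assms zero_less_one unfolding has_strict_derivative_def by blast+
  \<comment> \<open>Fixing the second point of the pair at \<open>p\<close> leaves the ordinary
    one-point estimate.\<close>
  have "((\<lambda>x. (x, p)) \<longlongrightarrow> (p, p)) (nhds p)"
    by (intro tendsto_intros) (simp add: filterlim_ident)
  from eventually_compose_filterlim[OF ev this]
  have le: "\<forall>\<^sub>F x in nhds p. norm (f x - f p - L (x - p)) \<le> norm (x - p)" by simp
  have "((\<lambda>x. x - p) \<longlongrightarrow> p - p) (nhds p)"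
    by (intro tendsto_intros) (simp add: filterlim_ident)
  then have d: "((\<lambda>x. x - p) \<longlongrightarrow> 0) (nhds p)" by simp
  have "((\<lambda>x. f x - f p - L (x - p)) \<longlongrightarrow> 0) (nhds p)"
    using Lim_null_comparison[OF le tendsto_norm_zero[OF d]] .
  from tendsto_add[OF this bounded_linear.tendsto_zero[OF L d]]
  have "((\<lambda>x. f x - f p) \<longlongrightarrow> 0) (nhds p)" by simp
  then have "(f \<longlongrightarrow> f p) (nhds p)" by (rule LIM_zero_cancel)
  then show ?thesis
    unfolding isCont_def tendsto_at_iff_tendsto_nhds .
qed

lemma has_strict_derivative_tendsto:
  assumes "has_strict_derivative f L p"
  shows "((\<lambda>z. f (fst z)) \<longlongrightarrow> f p) (nhds (p, p))" "((\<lambda>z. f (snd z)) \<longlongrightarrow> f p) (nhds (p, p))"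
proof -
  have f: "(f \<longlongrightarrow> f p) (nhds p)"
    using has_strict_derivative_imp_isCont[OF assms]
    by (simp add: isCont_def tendsto_at_iff_tendsto_nhds)
  have "(fst \<longlongrightarrow> p) (nhds (p, p))" "(snd \<longlongrightarrow> p) (nhds (p, p))"
    using tendsto_fst[OF filterlim_ident, of "(p, p)"] tendsto_snd[OF filterlim_ident, of "(p, p)"]
    by auto
  then show "((\<lambda>z. f (fst z)) \<longlongrightarrow> f p) (nhds (p, p))" "((\<lambda>z. f (snd z)) \<longlongrightarrow> f p) (nhds (p, p))"
    using f filterlim_compose by blast+
qed

lemma bounded_linear_bound:
  assumes "bounded_linear L"
  obtains K where "K \<ge> 0" "\<And>v. norm (L v) \<le> K * norm v"
  using bounded_linear.nonneg_bounded[OF assms] by (auto simp: mult.commute)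

lemma has_strict_derivative_mult:
  fixes f g :: "'a::real_normed_vector \<Rightarrow> 'b::real_normed_algebra"
  assumes f: "has_strict_derivative f L p" and g: "has_strict_derivative g M p"
  shows "has_strict_derivative (\<lambda>x. f x * g x) (\<lambda>v. f p * M v + L v * g p) p"
  unfolding has_strict_derivative_def
proof (intro conjI allI impI)
  have L: "bounded_linear L" and M: "bounded_linear M"
    using f g by (auto simp: has_strict_derivative_def)
  show "bounded_linear (\<lambda>v. f p * M v + L v * g p)"
    by (intro bounded_linear_add bounded_linear_const_mult bounded_linear_mult_const L M)
  obtain K where K: "K \<ge> 0" "\<And>v. norm (L v) \<le> K * norm v" using bounded_linear_bound[OF L] by blast
  obtain K' where K': "K' \<ge> 0" "\<And>v. norm (M v) \<le> K' * norm v" using bounded_linear_bound[OF M] by blast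
  fix e :: real assume "e > 0"
  \<comment> \<open>\<open>C\<close> is the total coefficient of \<open>r * norm h\<close> in the
    final estimate. The cap \<open>r \<le> 1\<close> gives the bounds \<open>norm (g p) + 1\<close>
    and \<open>norm (f p) + 1\<close> on the nearby values.\<close>
  define C where "C = norm (g p) + 1 + (norm (f p) + 1) + K + K'"
  have C: "C > 0" using K K' by (auto simp: C_def intro!: add_pos_nonneg)
  define r where "r = min 1 (e / C)"
  have r: "r > 0" "r \<le> 1" "r * C \<le> e" using C \<open>e > 0\<close> by (auto simp: r_def min_def field_simps)
  have
    "\<forall>\<^sub>F z in nhds (p, p). norm (f (fst z) - f (snd z) - L (fst z - snd z)) \<le> r * norm (fst z - snd z)"
    "\<forall>\<^sub>F z in nhds (p, p). norm (g (fst z) - g (snd z) - M (fst z - snd z)) \<le> r * norm (fst z - snd z)"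
    using f g r unfolding has_strict_derivative_def by blast+
  moreover have "\<forall>\<^sub>F z in nhds (p, p). dist (g (fst z)) (g p) < r"
    "\<forall>\<^sub>F z in nhds (p, p). dist (f (snd z)) (f p) < r"
    using has_strict_derivative_tendsto[OF f] has_strict_derivative_tendsto[OF g] r by (auto dest: tendstoD)
  ultimately show "\<forall>\<^sub>F z in nhds (p, p). norm (f (fst z) * g (fst z) - f (snd z) * g (snd z)
        - (f p * M (fst z - snd z) + L (fst z - snd z) * g p)) \<le> e * norm (fst z - snd z)"
  proof eventually_elim
    case (elim z)
    define x where "x = fst z"
    define y where "y = snd z"
    define h where "h = x - y"
    note el = elim[folded x_def y_def, folded h_def]
    have gx: "norm (g x) \<le> norm (g p) + 1" and fy: "norm (f y) \<le> norm (f p) + 1"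
      using el r norm_triangle_sub[of "g x" "g p"] norm_triangle_sub[of "f y" "f p"] by (auto simp: dist_norm)
    \<comment> \<open>The two remainders come first; the last two terms are the errors of freezing
      \<open>g x\<close> and \<open>f y\<close> at \<open>p\<close> in the linear part, which
      continuity makes small.\<close>
    have "f x * g x - f y * g y - (f p * M h + L h * g p)
      = (f x - f y - L h) * g x + f y * (g x - g y - M h) + L h * (g x - g p) + (f y - f p) * M h"
      by (simp add: algebra_simps)
    also have "norm \<dots> \<le> norm (f x - f y - L h) * norm (g x) + norm (f y) * norm (g x - g y - M h)
       + norm (L h) * norm (g x - g p) + norm (f y - f p) * norm (M h)"
      by (intro norm_triangle_le add_mono norm_mult_ineq)
    also have "\<dots> \<le> (r * norm h) * (norm (g p) + 1) + (norm (f p) + 1) * (r * norm h)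
       + (K * norm h) * r + r * (K' * norm h)"
      using el gx fy K K' r by (intro add_mono mult_mono) (auto simp: dist_norm)
    also have "\<dots> = (r * C) * norm h" by (simp add: C_def algebra_simps)
    also have "\<dots> \<le> e * norm h" using r by (intro mult_right_mono) auto
    finally show ?case by (simp add: x_def y_def h_def)
  qed
qed

lemma has_strict_derivative_inverse:
  fixes f :: "'a::real_normed_vector \<Rightarrow> 'b::real_normed_field"
  assumes f: "has_strict_derivative f L p" and nz: "f p \<noteq> 0"
  shows "has_strict_derivative (\<lambda>x. inverse (f x)) (\<lambda>v. - (L v / (f p * f p))) p"
  unfolding has_strict_derivative_def
proof (intro conjI allI impI)
  have L: "bounded_linear L" using f by (auto simp: has_strict_derivative_def)
  show "bounded_linear (\<lambda>v. - (L v / (f p * f p)))"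
    by (intro bounded_linear_minus bounded_linear_compose[OF bounded_linear_divide L, unfolded o_def]) 
  obtain K where K: "K \<ge> 0" "\<And>v. norm (L v) \<le> K * norm v" using bounded_linear_bound[OF L] by blast
  define q where "q = inverse (f p * f p)"
  define C where "C = norm q + 1 + K"
  have C: "C > 0" using K norm_ge_zero[of q] unfolding C_def by linarith
  fix e :: real assume "e > 0"
  define r where "r = min 1 (e / C)"
  have r: "r > 0" "r \<le> 1" "r * C \<le> e" using C \<open>e > 0\<close> by (auto simp: r_def min_def field_simps)
  note t = has_strict_derivative_tendsto[OF f]
  have "((\<lambda>z. inverse (f (fst z) * f (snd z))) \<longlongrightarrow> q) (nhds (p, p))"
    unfolding q_def by (intro tendsto_intros t) (use nz in auto)
  then have "\<forall>\<^sub>F z in nhds (p, p). dist (inverse (f (fst z) * f (snd z))) q < r"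
    using r by (auto dest: tendstoD)
  moreover have "\<forall>\<^sub>F z in nhds (p, p). f (fst z) \<noteq> 0" "\<forall>\<^sub>F z in nhds (p, p). f (snd z) \<noteq> 0"
    using t nz by (auto dest: tendsto_imp_eventually_ne)
  moreover have
    "\<forall>\<^sub>F z in nhds (p, p). norm (f (fst z) - f (snd z) - L (fst z - snd z)) \<le> r * norm (fst z - snd z)"
    using f r unfolding has_strict_derivative_def by blast
  ultimately show "\<forall>\<^sub>F z in nhds (p, p). norm (inverse (f (fst z)) - inverse (f (snd z))
        - - (L (fst z - snd z) / (f p * f p))) \<le> e * norm (fst z - snd z)"
  proof eventually_elim
    case (elim z)
    define x where "x = fst z"
    define y where "y = snd z"
    define h where "h = x - y"
    \<comment> \<open>The difference of the inverses is \<open>- ((f x - f y) * s)\<close> with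
      \<open>s\<close> close to \<open>q\<close>, so an estimate as for products applies to this
      factorisation.\<close>
    define s where "s = inverse (f x * f y)"
    note el = elim[folded x_def y_def, folded h_def s_def]
    have s: "norm s \<le> norm q + 1"
      using el r norm_triangle_sub[of s q] by (auto simp: dist_norm)
    have "inverse (f x) - inverse (f y) = - ((f x - f y) * s)"
      using el by (simp add: s_def field_simps)
    then have "inverse (f x) - inverse (f y) - - (L h / (f p * f p))
      = - ((f x - f y - L h) * s + L h * (s - q))"
      by (simp add: algebra_simps q_def divide_inverse)
    also have "norm \<dots> \<le> norm (f x - f y - L h) * norm s + norm (L h) * norm (s - q)"
      unfolding norm_minus_cancel by (intro norm_triangle_le add_mono norm_mult_ineq)
    also have "\<dots> \<le> (r * norm h) * (norm q + 1) + (K * norm h) * r"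
      using el s K r by (intro add_mono mult_mono) (auto simp: dist_norm)
    also have "\<dots> = (r * C) * norm h" by (simp add: C_def algebra_simps)
    also have "\<dots> \<le> e * norm h" using r by (intro mult_right_mono) auto
    finally show ?case by (simp add: x_def y_def h_def)
  qed
qed

lemma has_strict_derivative_divide:
  fixes f g :: "'a::real_normed_vector \<Rightarrow> 'b::real_normed_field"
  assumes "has_strict_derivative f L p" "has_strict_derivative g M p" "g p \<noteq> 0"
  shows "has_strict_derivative (\<lambda>x. f x / g x) (\<lambda>v. (L v * g p - f p * M v) / (g p * g p)) p"
proof -
  have "f p * - (M v / (g p * g p)) + L v * inverse (g p) = (L v * g p - f p * M v) / (g p * g p)" for v
    using assms(3) by (simp add: divide_simps)
  then show ?thesis
    using has_strict_derivative_mult[OF assms(1) has_strict_derivative_inverse[OF assms(2,3)]]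
    by (simp add: divide_inverse)
qed

lemma has_strict_derivative_power:
  fixes f :: "'a::real_normed_vector \<Rightarrow> 'b::real_normed_field"
  assumes "has_strict_derivative f L p"
  shows "has_strict_derivative (\<lambda>x. f x ^ n) (\<lambda>v. of_nat n * f p ^ (n - 1) * L v) p"
proof (induction n)
  case 0
  show ?case by (simp add: has_strict_derivative_const)
next
  case (Suc n)
  have "f p * (of_nat n * f p ^ (n - 1) * L v) + L v * f p ^ n = of_nat (Suc n) * f p ^ n * L v" for v
    by (cases n) (simp_all add: algebra_simps)
  then show ?case
    using has_strict_derivative_mult[OF assms Suc.IH] by simp
qed

lemma has_strict_derivative_eq_rhs:
  "has_strict_derivative f L p \<Longrightarrow> L = M \<Longrightarrow> has_strict_derivative f M p"
  by simp

lemmas has_strict_derivative_intros =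
  has_strict_derivative_const
  has_strict_derivative_bounded_linear[OF bounded_linear_fst]
  has_strict_derivative_bounded_linear[OF bounded_linear_snd]
  has_strict_derivative_add has_strict_derivative_diff has_strict_derivative_mult
  has_strict_derivative_divide has_strict_derivative_power

subsection \<open>Holomorphic stable manifolds of planar saddles\<close>

lemma has_strict_derivative_pair_bound:
  fixes f :: "'a::real_normed_vector \<times> 'b::real_normed_vector \<Rightarrow> 'c::real_normed_vector"
  assumes "has_strict_derivative f L 0" and "e > 0"
  obtains d where "d > 0"
    "\<And>u v x y. \<lbrakk>norm u < d; norm v < d; norm x < d; norm y < d\<rbrakk> \<Longrightarrow>
       norm (f (u, x) - f (v, y) - L (u - v, x - y)) \<le> e * (norm (u - v) + norm (x - y))"
proof -
  have "\<forall>\<^sub>F z in nhds (0, 0). norm (f (fst z) - f (snd z) - L (fst z - snd z)) \<le> e * norm (fst z - snd z)"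
    using assms unfolding has_strict_derivative_def by blast
  then obtain d where d: "d > 0"
    "\<And>z. dist z (0, 0) < d \<Longrightarrow> norm (f (fst z) - f (snd z) - L (fst z - snd z)) \<le> e * norm (fst z - snd z)"
    unfolding eventually_nhds_metric by blast
  show thesis
  proof
    \<comment> \<open>Four norms below \<open>d / 4\<close> keep the pair of points within distance
      \<open>d\<close> of the origin.\<close>
    show "d / 4 > 0" using d by simp
    fix u v :: 'a and x y :: 'b
    assume a: "norm u < d / 4" "norm v < d / 4" "norm x < d / 4" "norm y < d / 4"
    have "norm ((u, x), (v, y)) \<le> norm (u, x) + norm (v, y)" by (rule norm_Pair_le)
    also have "\<dots> \<le> (norm u + norm x) + (norm v + norm y)" by (intro add_mono norm_Pair_le)
    also have "\<dots> < d" using a by linarith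
    finally have "dist ((u, x), (v, y)) (0, 0) < d" by (simp add: dist_norm zero_prod_def)
    from d(2)[OF this]
    have "norm (f (u, x) - f (v, y) - L (u - v, x - y)) \<le> e * norm (u - v, x - y)" by simp
    also have "\<dots> \<le> e * (norm (u - v) + norm (x - y))"
      using assms(2) by (intro mult_left_mono norm_Pair_le) auto
    finally show "norm (f (u, x) - f (v, y) - L (u - v, x - y)) \<le> e * (norm (u - v) + norm (x - y))" .
  qed
qed

text \<open>Hadamard's graph transform for the map \<open>(G, H)\<close>, whose linear part at the
  fixed point 0 contracts the first axis by \<nu> and expands the second by \<mu>. Holomorphy in two
  variables enters only through \<open>holG\<close> and \<open>holH\<close>, that is, along graphs
  of one-variable functions.\<close>

theorem holomorphic_stable_manifold:
  fixes G H :: "complex \<times> complex \<Rightarrow> complex" and \<nu> \<mu> :: complex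
  assumes G: "has_strict_derivative G (\<lambda>v. \<nu> * fst v) 0" and G0: "G 0 = 0"
    and H: "has_strict_derivative H (\<lambda>v. \<mu> * snd v) 0" and H0: "H 0 = 0"
    and \<nu>: "norm \<nu> < 1" and \<mu>: "norm \<mu> > 1" and "R > 0"
    and holG: "\<And>r \<phi>. \<lbrakk>r \<le> R; \<phi> holomorphic_on ball 0 r; \<And>w. w \<in> ball 0 r \<Longrightarrow> norm (\<phi> w) \<le> norm w\<rbrakk>
        \<Longrightarrow> (\<lambda>w. G (w, \<phi> w)) holomorphic_on ball 0 r"
    and holH: "\<And>r \<phi>. \<lbrakk>r \<le> R; \<phi> holomorphic_on ball 0 r; \<And>w. w \<in> ball 0 r \<Longrightarrow> norm (\<phi> w) \<le> norm w\<rbrakk>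
        \<Longrightarrow> (\<lambda>w. H (w, \<phi> w)) holomorphic_on ball 0 r"
  obtains r q \<phi> where "0 < r" "r \<le> R" "0 \<le> q" "q < 1" "\<phi> holomorphic_on ball 0 r"
    "\<And>w. w \<in> ball 0 r \<Longrightarrow> norm (\<phi> w) \<le> norm w"
    "\<And>w. w \<in> ball 0 r \<Longrightarrow> norm (G (w, \<phi> w)) \<le> q * norm w"
    "\<And>w. w \<in> ball 0 r \<Longrightarrow> H (w, \<phi> w) = \<phi> (G (w, \<phi> w))"
proof -
  \<comment> \<open>The margin 4\<eta> serves three purposes: \<open>q < 1\<close> (contraction
    along the graph), \<open>norm \<nu> + 4 * \<eta> \<le> norm \<mu>\<close> (the transform
    preserves the Lipschitz constant 1) and \<open>\<kappa> < 1\<close> (the transform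
    contracts).\<close>
  define \<eta> where "\<eta> = min ((1 - norm \<nu>) / 4) ((norm \<mu> - 1) / 4)"
  have \<eta>: "\<eta> > 0" "norm \<nu> + 4 * \<eta> \<le> 1" "1 + 4 * \<eta> \<le> norm \<mu>"
  proof -
    have "\<eta> \<le> (1 - norm \<nu>) / 4" "\<eta> \<le> (norm \<mu> - 1) / 4" unfolding \<eta>_def by (rule min.cobounded1, rule min.cobounded2)
    then show "norm \<nu> + 4 * \<eta> \<le> 1" and "1 + 4 * \<eta> \<le> norm \<mu>" by simp_all
    show "\<eta> > 0" using \<nu> \<mu> by (simp add: \<eta>_def)
  qed
  obtain d1 where d1: "d1 > 0"
    "\<And>u v x y. \<lbrakk>norm u < d1; norm v < d1; norm x < d1; norm y < d1\<rbrakk> \<Longrightarrow>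
       norm (G (u, x) - G (v, y) - \<nu> * (u - v)) \<le> \<eta> * (norm (u - v) + norm (x - y))"
    using has_strict_derivative_pair_bound[OF G \<eta>(1)] by (metis fst_conv)
  obtain d2 where d2: "d2 > 0"
    "\<And>u v x y. \<lbrakk>norm u < d2; norm v < d2; norm x < d2; norm y < d2\<rbrakk> \<Longrightarrow>
       norm (H (u, x) - H (v, y) - \<mu> * (x - y)) \<le> \<eta> * (norm (u - v) + norm (x - y))"
    using has_strict_derivative_pair_bound[OF H \<eta>(1)] by (metis snd_conv)
  define r where "r = min R (min d1 d2)"
  have r: "0 < r" "r \<le> R" "r \<le> d1" "r \<le> d2" using d1 d2 \<open>R > 0\<close> by (auto simp: r_def)
  define B where "B = ball (0::complex) r"
  have B: "w \<in> B \<longleftrightarrow> norm w < r" for w by (simp add: B_def)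
  \<comment> \<open>Lipschitz constant 1 and \<open>\<phi> 0 = 0\<close> confine the graph to the
    region where the estimates on \<open>G\<close> and \<open>H\<close> hold, and all three
    conditions survive uniform limits.\<close>
  define \<P> where "\<P> \<phi> \<longleftrightarrow> \<phi> holomorphic_on B \<and> \<phi> 0 = 0 \<and> (\<forall>u\<in>B. \<forall>v\<in>B. norm (\<phi> u - \<phi> v) \<le> norm (u - v))"
    for \<phi> :: "complex \<Rightarrow> complex"
  txt \<open>Graph transform: solving \<open>H (w, \<phi> w) = \<phi> (G (w, \<phi> w))\<close> for the linear part \<open>\<mu> \<phi> w\<close> of \<open>H\<close>
    turns the expansion \<open>\<bar>\<mu>\<bar> > 1\<close> into a contraction on the 1-Lipschitz holomorphic graphs.\<close>
  define T where "T \<phi> = (\<lambda>w. (\<phi> (G (w, \<phi> w)) - (H (w, \<phi> w) - \<mu> * \<phi> w)) / \<mu>)" for \<phi> :: "complex \<Rightarrow> complex"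
  define q where "q = norm \<nu> + 2 * \<eta>"
  have q: "0 \<le> q" "q < 1" using \<eta> by (auto simp: q_def)
  define \<kappa> where "\<kappa> = (1 + 2 * \<eta>) / norm \<mu>"
  have \<kappa>: "0 \<le> \<kappa>" "\<kappa> < 1" using \<eta> by (auto simp: \<kappa>_def divide_simps)

  have bound: "norm (\<phi> w) \<le> norm w" if "\<P> \<phi>" "w \<in> B" for \<phi> w
  proof -
    have "0 \<in> B" using r by (simp add: B)
    then have "norm (\<phi> w - \<phi> 0) \<le> norm (w - 0)" using that unfolding \<P>_def by blast
    then show ?thesis using that by (simp add: \<P>_def)
  qed
  have in_B: "\<phi> w \<in> B" if "\<P> \<phi>" "w \<in> B" for \<phi> w
    using bound[OF that] that by (simp add: B)
  have lipG: "norm (G (u, x) - G (v, y) - \<nu> * (u - v)) \<le> \<eta> * (norm (u - v) + norm (x - y))"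
    and lipH: "norm (H (u, x) - H (v, y) - \<mu> * (x - y)) \<le> \<eta> * (norm (u - v) + norm (x - y))"
    if "u \<in> B" "v \<in> B" "x \<in> B" "y \<in> B" for u v x y
    using that r by (auto simp: B intro!: d1(2) d2(2))
  have lipG': "norm (G (u, \<phi> u) - G (v, \<phi> v)) \<le> q * norm (u - v)"
    if "\<P> \<phi>" "u \<in> B" "v \<in> B" for \<phi> u v
  proof -
    have "norm (G (u, \<phi> u) - G (v, \<phi> v))
      \<le> norm (\<nu> * (u - v)) + norm (G (u, \<phi> u) - G (v, \<phi> v) - \<nu> * (u - v))"
      by (rule norm_triangle_sub)
    also have "\<dots> \<le> norm (\<nu> * (u - v)) + \<eta> * (norm (u - v) + norm (\<phi> u - \<phi> v))"
      using that in_B by (intro add_left_mono lipG) auto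
    also have "\<dots> \<le> norm (\<nu> * (u - v)) + \<eta> * (norm (u - v) + norm (u - v))"
      using that \<eta>(1) by (intro add_left_mono mult_left_mono) (auto simp: \<P>_def)
    also have "\<dots> = q * norm (u - v)" unfolding norm_mult by (simp add: q_def algebra_simps)
    finally show ?thesis .
  qed
  have G_bound: "norm (G (w, \<phi> w)) \<le> q * norm w" if "\<P> \<phi>" "w \<in> B" for \<phi> w
  proof -
    have "\<phi> 0 = 0" using that by (simp add: \<P>_def)
    then show ?thesis
      using lipG'[of \<phi> w 0] that r G0 by (simp add: B zero_prod_def)
  qed
  have G_in_B: "G (w, \<phi> w) \<in> B" if "\<P> \<phi>" "w \<in> B" for \<phi> w
  proof -
    have "q * norm w \<le> 1 * norm w" using q by (intro mult_right_mono) auto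
    then show ?thesis using G_bound[OF that] that by (simp add: B)
  qed

  have \<P>_T: "\<P> (T \<phi>)" if \<phi>: "\<P> \<phi>" for \<phi>
  proof -
    have hol: "\<phi> holomorphic_on B" and \<phi>0: "\<phi> 0 = 0" using \<phi> by (auto simp: \<P>_def)
    have hG: "(\<lambda>w. G (w, \<phi> w)) holomorphic_on B"
      using holG[of r \<phi>] r hol bound[OF \<phi>] by (simp add: B_def)
    have hH: "(\<lambda>w. H (w, \<phi> w)) holomorphic_on B"
      using holH[of r \<phi>] r hol bound[OF \<phi>] by (simp add: B_def)
    have "(\<lambda>w. \<phi> (G (w, \<phi> w))) holomorphic_on B"
      using holomorphic_on_compose_gen[OF hG hol] G_in_B[OF \<phi>] by (auto simp: o_def)
    then have "T \<phi> holomorphic_on B"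
      unfolding T_def using hH hol \<mu> by (intro holomorphic_intros) auto
    moreover have "T \<phi> 0 = 0"
      using \<phi>0 G0 H0 by (simp add: T_def zero_prod_def)
    moreover have "norm (T \<phi> u - T \<phi> v) \<le> norm (u - v)" if uv: "u \<in> B" "v \<in> B" for u v
    proof -
      have "T \<phi> u - T \<phi> v = ((\<phi> (G (u, \<phi> u)) - \<phi> (G (v, \<phi> v)))
        - (H (u, \<phi> u) - H (v, \<phi> v) - \<mu> * (\<phi> u - \<phi> v))) / \<mu>"
        unfolding T_def diff_divide_distrib[symmetric]
        by (rule arg_cong[where f = "\<lambda>x. x / \<mu>"]) (simp add: algebra_simps)
      then have "norm (T \<phi> u - T \<phi> v) \<le> (norm (\<phi> (G (u, \<phi> u)) - \<phi> (G (v, \<phi> v)))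
        + norm (H (u, \<phi> u) - H (v, \<phi> v) - \<mu> * (\<phi> u - \<phi> v))) / norm \<mu>"
        by (simp add: norm_divide divide_right_mono norm_triangle_ineq4)
      \<comment> \<open>The 1-Lipschitz \<phi> does not enlarge the contraction by \<open>q\<close>,
        and the nonlinear part of \<open>H\<close> adds another 2\<eta>.\<close>
      also have "\<dots> \<le> (q * norm (u - v) + \<eta> * (norm (u - v) + norm (u - v))) / norm \<mu>"
      proof (intro divide_right_mono add_mono)
        have "norm (\<phi> (G (u, \<phi> u)) - \<phi> (G (v, \<phi> v))) \<le> norm (G (u, \<phi> u) - G (v, \<phi> v))"
          using \<phi> G_in_B[OF \<phi>] uv by (auto simp: \<P>_def)
        also have "\<dots> \<le> q * norm (u - v)" using lipG' \<phi> uv by blast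
        finally show "norm (\<phi> (G (u, \<phi> u)) - \<phi> (G (v, \<phi> v))) \<le> q * norm (u - v)" .
        have "norm (H (u, \<phi> u) - H (v, \<phi> v) - \<mu> * (\<phi> u - \<phi> v)) \<le> \<eta> * (norm (u - v) + norm (\<phi> u - \<phi> v))"
          using uv in_B[OF \<phi>] by (intro lipH) auto
        also have "\<dots> \<le> \<eta> * (norm (u - v) + norm (u - v))"
          using \<phi> uv \<eta>(1) by (intro mult_left_mono add_mono) (auto simp: \<P>_def)
        finally show "norm (H (u, \<phi> u) - H (v, \<phi> v) - \<mu> * (\<phi> u - \<phi> v)) \<le> \<eta> * (norm (u - v) + norm (u - v))" .
      qed auto
      also have "\<dots> = (norm \<nu> + 4 * \<eta>) / norm \<mu> * norm (u - v)"
        by (simp add: q_def algebra_simps)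
      also have "\<dots> \<le> 1 * norm (u - v)"
        using \<eta> \<mu> by (intro mult_right_mono) (auto simp: divide_simps)
      finally show ?thesis by simp
    qed
    ultimately show ?thesis by (simp add: \<P>_def)
  qed

  have contract: "norm (T \<phi> w - T \<psi> w) \<le> \<kappa> * c"
    if \<phi>: "\<P> \<phi>" and \<psi>: "\<P> \<psi>" and c: "\<And>u. u \<in> B \<Longrightarrow> norm (\<phi> u - \<psi> u) \<le> c" and w: "w \<in> B" for \<phi> \<psi> c w
  proof -
    define a where "a = G (w, \<phi> w)"
    define b where "b = G (w, \<psi> w)"
    have ab: "a \<in> B" "b \<in> B" using G_in_B \<phi> \<psi> w by (auto simp: a_def b_def)
    \<comment> \<open>Inserting \<open>\<psi> a\<close> separates the change of function from the
      change of argument. Since \<open>a\<close> and \<open>b\<close> have the same base point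
      \<open>w\<close>, the \<nu>-part cancels and they differ by at most
      \<open>\<eta> * c\<close>.\<close>
    have "T \<phi> w - T \<psi> w = ((\<phi> a - \<psi> a) + (\<psi> a - \<psi> b)
        - (H (w, \<phi> w) - H (w, \<psi> w) - \<mu> * (\<phi> w - \<psi> w))) / \<mu>"
      unfolding T_def diff_divide_distrib[symmetric] a_def b_def
      by (rule arg_cong[where f = "\<lambda>x. x / \<mu>"]) (simp add: algebra_simps)
    moreover have "norm (x + y - z) \<le> norm x + norm y + norm z" for x y z :: complex
      using norm_triangle_ineq4[of "x + y" z] norm_triangle_ineq[of x y] by linarith
    ultimately have "norm (T \<phi> w - T \<psi> w) \<le> (norm (\<phi> a - \<psi> a) + norm (\<psi> a - \<psi> b)
        + norm (H (w, \<phi> w) - H (w, \<psi> w) - \<mu> * (\<phi> w - \<psi> w))) / norm \<mu>"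
      by (simp only: norm_divide) (intro divide_right_mono norm_ge_zero)
    also have "\<dots> \<le> (c + \<eta> * c + \<eta> * c) / norm \<mu>"
    proof (intro divide_right_mono add_mono)
      show "norm (\<phi> a - \<psi> a) \<le> c" using c ab by blast
      have "norm (a - b - \<nu> * (w - w)) \<le> \<eta> * (norm (w - w) + norm (\<phi> w - \<psi> w))"
        unfolding a_def b_def using w in_B \<phi> \<psi> by (intro lipG) auto
      also have "\<dots> \<le> \<eta> * c" using c[OF w] \<eta>(1) by simp
      finally have "norm (a - b) \<le> \<eta> * c" by simp
      then show "norm (\<psi> a - \<psi> b) \<le> \<eta> * c"
        using \<psi> ab order.trans unfolding \<P>_def by blast
      have "norm (H (w, \<phi> w) - H (w, \<psi> w) - \<mu> * (\<phi> w - \<psi> w)) \<le> \<eta> * (norm (w - w) + norm (\<phi> w - \<psi> w))"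
        using w in_B \<phi> \<psi> by (intro lipH) auto
      also have "\<dots> \<le> \<eta> * c" using c[OF w] \<eta>(1) by simp
      finally show "norm (H (w, \<phi> w) - H (w, \<psi> w) - \<mu> * (\<phi> w - \<psi> w)) \<le> \<eta> * c" .
    qed auto
    also have "\<dots> = \<kappa> * c" by (simp add: \<kappa>_def algebra_simps)
    finally show ?thesis .
  qed

  \<comment> \<open>Picard iteration from the zero graph. Successive differences decay like
    \<open>\<kappa> ^ n\<close> uniformly on \<open>B\<close>, so the telescoping series converges
    by the M-test.\<close>
  define \<Phi> where "\<Phi> n = (T ^^ n) (\<lambda>_. 0)" for n
  have \<Phi>_Suc: "\<Phi> (Suc n) = T (\<Phi> n)" for n by (simp add: \<Phi>_def)
  have \<P>_\<Phi>: "\<P> (\<Phi> n)" for n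
  proof (induction n)
    case 0
    show ?case by (simp add: \<P>_def \<Phi>_def)
  qed (simp add: \<Phi>_Suc \<P>_T)
  have step: "norm (\<Phi> (Suc n) w - \<Phi> n w) \<le> r * \<kappa> ^ n" if "w \<in> B" for n w
    using that
  proof (induction n arbitrary: w)
    case 0
    then show ?case using in_B[OF \<P>_\<Phi>[of 1] 0] by (simp add: \<Phi>_def B)
  next
    case (Suc n)
    then have "norm (T (\<Phi> (Suc n)) w - T (\<Phi> n) w) \<le> \<kappa> * (r * \<kappa> ^ n)"
      by (intro contract \<P>_\<Phi>)
    then show ?case by (simp add: \<Phi>_Suc mult.left_commute)
  qed
  define \<phi> where "\<phi> w = (\<Sum>n. \<Phi> (Suc n) w - \<Phi> n w)" for w
  have "uniform_limit B (\<lambda>n w. \<Sum>i<n. \<Phi> (Suc i) w - \<Phi> i w) \<phi> sequentially"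
    unfolding \<phi>_def using step \<kappa> by (intro Weierstrass_m_test summable_mult summable_geometric) auto
  moreover have "(\<Sum>i<n. \<Phi> (Suc i) w - \<Phi> i w) = \<Phi> n w" for n w
  proof -
    have "\<Phi> 0 w = 0" by (simp add: \<Phi>_def)
    then show ?thesis using sum_lessThan_telescope[of "\<lambda>i. \<Phi> i w" n] by simp
  qed
  ultimately have ul: "uniform_limit B \<Phi> \<phi> sequentially" by simp
  have lim: "(\<lambda>n. \<Phi> n w) \<longlonglongrightarrow> \<phi> w" if "w \<in> B" for w
    using tendsto_uniform_limitI[OF ul that] .
  have "\<P> \<phi>"
    unfolding \<P>_def
  proof (intro conjI ballI)
    show "\<phi> holomorphic_on B"
      unfolding B_def
    proof (rule holomorphic_uniform_sequence[OF open_ball, where f = \<Phi>])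
      show "\<Phi> n holomorphic_on ball 0 r" for n using \<P>_\<Phi>[of n] by (simp add: \<P>_def B_def)
      fix x :: complex assume "x \<in> ball 0 r"
      then obtain d where "d > 0" "cball x d \<subseteq> ball 0 r" using open_contains_cball open_ball by blast
      then show "\<exists>d>0. cball x d \<subseteq> ball 0 r \<and> uniform_limit (cball x d) \<Phi> \<phi> sequentially"
        using uniform_limit_on_subset[OF ul] unfolding B_def by blast
    qed
    have "0 \<in> B" using r by (simp add: B)
    moreover have "\<Phi> n 0 = 0" for n using \<P>_\<Phi>[of n] by (simp add: \<P>_def)
    ultimately show "\<phi> 0 = 0" using lim[of 0] by (simp add: LIMSEQ_const_iff)
    fix u v assume "u \<in> B" "v \<in> B"
    then have "(\<lambda>n. norm (\<Phi> n u - \<Phi> n v)) \<longlonglongrightarrow> norm (\<phi> u - \<phi> v)"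
      by (intro tendsto_intros lim)
    then show "norm (\<phi> u - \<phi> v) \<le> norm (u - v)"
      using \<P>_\<Phi> \<open>u \<in> B\<close> \<open>v \<in> B\<close> by (intro LIMSEQ_le_const2) (auto simp: \<P>_def)
  qed
  \<comment> \<open>Both \<open>\<phi> w\<close> and \<open>T \<phi> w\<close> are limits of the
    shifted iterates, the latter because \<open>T\<close> contracts the uniform distance.\<close>
  have fixed: "T \<phi> w = \<phi> w" if w: "w \<in> B" for w
  proof (rule LIMSEQ_unique)
    show "(\<lambda>n. \<Phi> (Suc n) w) \<longlonglongrightarrow> \<phi> w" using lim[OF w] by (rule LIMSEQ_Suc)
    show "(\<lambda>n. \<Phi> (Suc n) w) \<longlonglongrightarrow> T \<phi> w"
    proof (rule tendstoI)
      fix e :: real assume "e > 0"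
      with ul have "\<forall>\<^sub>F n in sequentially. \<forall>u\<in>B. dist (\<Phi> n u) (\<phi> u) < e"
        by (rule uniform_limitD)
      then show "\<forall>\<^sub>F n in sequentially. dist (\<Phi> (Suc n) w) (T \<phi> w) < e"
      proof eventually_elim
        case (elim n)
        then have "norm (T (\<Phi> n) w - T \<phi> w) \<le> \<kappa> * e"
          using w by (intro contract \<P>_\<Phi> \<open>\<P> \<phi>\<close>) (auto simp: dist_norm intro: less_imp_le)
        also have "\<dots> < 1 * e" using \<kappa> \<open>e > 0\<close> by (intro mult_strict_right_mono)
        finally show ?case by (simp add: \<Phi>_Suc dist_norm)
      qed
    qed
  qed
  have "H (w, \<phi> w) = \<phi> (G (w, \<phi> w))" if "w \<in> B" for w
  proof -
    have "\<mu> \<noteq> 0" using \<mu> by auto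
    then show ?thesis using fixed[OF that] by (simp add: T_def field_simps)
  qed
  then show thesis
    using that[of r q \<phi>] r q \<open>\<P> \<phi>\<close> bound G_bound by (simp add: \<P>_def B_def)
qed

subsection \<open>The cubic Weierstrass map near infinity\<close>

text \<open>The coordinates have mean \<open>m\<close>, and those numbered 2 and 3 differ by
  \<open>y / w\<close>; negating \<open>y\<close> swaps them. For \<open>w \<noteq> 0\<close>,
  collisions occur exactly at \<open>y = 0\<close> and \<open>y ^ 2 = 9\<close>.\<close>

definition cubic_point :: "complex \<Rightarrow> complex \<Rightarrow> complex \<Rightarrow> complex^3" where
  "cubic_point m w y = vector [m + 1 / w, m + (y - 1) / (2 * w), m - (y + 1) / (2 * w)]"

text \<open>
  For \<open>Z^3 + a Z - b\<close> the Weierstrass map sends the parameters \<open>(w, y)\<close> to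
  \<open>(step_scale a b w y, - step_shape a b w y)\<close>; the sign is absorbed by the transposition symmetry.
\<close>

definition step_denom :: "complex \<Rightarrow> complex \<Rightarrow> complex \<Rightarrow> complex \<Rightarrow> complex" where
  "step_denom a b w y = 5 - y ^ 2 + 4 * b * w ^ 3 - 4 * a * w ^ 2"

definition step_scale :: "complex \<Rightarrow> complex \<Rightarrow> complex \<Rightarrow> complex \<Rightarrow> complex" where
  "step_scale a b w y = w * (9 - y ^ 2) / step_denom a b w y"

definition step_shape :: "complex \<Rightarrow> complex \<Rightarrow> complex \<Rightarrow> complex \<Rightarrow> complex" where
  "step_shape a b w y =
     (y ^ 4 - 12 * y ^ 2 + 3 + 24 * b * w ^ 3 - 4 * a * w ^ 2 * (y ^ 2 - 3)) / (2 * y * step_denom a b w y)"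

text \<open>These parities express the equivariance of the Weierstrass map under swapping the last
  two coordinates, so one sign of \<open>y\<close> decides both.\<close>

lemma step_minus:
  "step_denom a b w (- y) = step_denom a b w y"
  "step_scale a b w (- y) = step_scale a b w y"
  "step_shape a b w (- y) = - step_shape a b w y"
  by (simp_all add: step_denom_def step_scale_def step_shape_def)

lemma off_diagonal_cubic_point:
  assumes "w \<noteq> 0" "y \<noteq> 0" "y ^ 2 \<noteq> 9"
  shows "off_diagonal (cubic_point m w y)"
proof -
  define z where "z = cubic_point m w y"
  have "y - 3 \<noteq> 0" "y + 3 \<noteq> 0" using assms by (auto simp: add_eq_0_iff2)
  moreover have "z $ 1 - z $ 2 = - ((y - 3) / (2 * w))" "z $ 1 - z $ 3 = (y + 3) / (2 * w)" "z $ 2 - z $ 3 = y / w"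
    using assms by (simp_all add: z_def cubic_point_def field_simps)
  ultimately have "z $ 1 - z $ 2 \<noteq> 0" "z $ 1 - z $ 3 \<noteq> 0" "z $ 2 - z $ 3 \<noteq> 0"
    using assms by simp_all
  then show ?thesis
    unfolding off_diagonal_def z_def[symmetric] forall_3 by auto
qed

lemma monic_cubic_depressed:
  fixes p :: "complex poly"
  assumes "degree p = 3"
  obtains m a b where "\<And>x. poly (smult (inverse (lead_coeff p)) p) x = (x - m) ^ 3 + a * (x - m) - b"
proof -
  define q where "q = smult (inverse (lead_coeff p)) p"
  have "p \<noteq> 0" using assms by auto
  then have "coeff q (degree p) = 1" by (simp add: q_def)
  moreover have "degree q = degree p" using \<open>p \<noteq> 0\<close> by (simp add: q_def)
  ultimately have q: "poly q x = coeff q 0 + coeff q 1 * x + coeff q 2 * x ^ 2 + x ^ 3" for x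
    using assms by (simp add: poly_altdef eval_nat_numeral)
  \<comment> \<open>The mean of the roots: centring there removes the quadratic term.\<close>
  define m where "m = - coeff q 2 / 3"
  define a where "a = coeff q 1 - 3 * m ^ 2"
  have "poly q x = (x - m) ^ 3 + a * (x - m) - (- (m ^ 3) - a * m - coeff q 0)" for x
  proof -
    have "coeff q 2 = - 3 * m" "coeff q 1 = a + 3 * m ^ 2" by (simp_all add: m_def a_def)
    then show ?thesis unfolding q by (simp add: algebra_simps power2_eq_square power3_eq_cube)
  qed
  then show thesis using that unfolding q_def by blast
qed

text \<open>Over the common denominator \<open>w * (9 - y ^ 2)\<close> the left side has numerator
  \<open>step_denom a b w y\<close>. If that vanishes, both sides are 0, because
  \<open>1 / 0 = 0\<close>.\<close>

lemma weierstrass_first_coordinate: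
  assumes "w \<noteq> 0" "y ^ 2 \<noteq> 9"
  shows "1 / w - ((1 / w) ^ 3 + a * (1 / w) - b) / (- ((y - 3) / (2 * w)) * ((y + 3) / (2 * w))) = 1 / step_scale a b w y"
proof -
  have "- ((y - 3) / (2 * w)) * ((y + 3) / (2 * w)) = (9 - y ^ 2) / (4 * w ^ 2)"
    by (simp add: algebra_simps power2_eq_square add_divide_distrib diff_divide_distrib)
  then show ?thesis
    using assms by (simp add: step_scale_def step_denom_def field_simps eval_nat_numeral)
qed

lemma weierstrass_second_coordinate:
  assumes w: "w \<noteq> 0" and y: "y \<noteq> 0" "y ^ 2 \<noteq> 9" and E: "step_denom a b w y \<noteq> 0"
  shows "(y - 1) / (2 * w) - (((y - 1) / (2 * w)) ^ 3 + a * ((y - 1) / (2 * w)) - b) / ((y - 3) / (2 * w) * (y / w))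
     = (- step_shape a b w y - 1) / (2 * step_scale a b w y)"
proof -
  define E where "E = step_denom a b w y"
  define S where "S = step_shape a b w y"
  have y3: "y - 3 \<noteq> 0" "y + 3 \<noteq> 0" "9 - y ^ 2 \<noteq> 0" using y by (auto simp: add_eq_0_iff2)
  have S: "S * (2 * y * E) = y ^ 4 - 12 * y ^ 2 + 3 + 24 * b * w ^ 3 - 4 * a * w ^ 2 * (y ^ 2 - 3)"
    using y E by (simp add: step_shape_def E_def S_def)
  have "(- S - 1) / (2 * step_scale a b w y) = - (S * (2 * y * E) + 2 * y * E) / (4 * y * w * (9 - y ^ 2))"
    unfolding step_scale_def E_def[symmetric] using y y3 w by (simp add: divide_simps) (simp add: algebra_simps)
  \<comment> \<open>The factor \<open>y + 3\<close> belongs to the difference of coordinates 1 and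
    3, which is absent from the correction of coordinate 2; it has to cancel against
    \<open>9 - y ^ 2\<close>.\<close>
  also have "S * (2 * y * E) + 2 * y * E
    = (y + 3) * ((y - 1) * (y ^ 2 - 4 * y - 1) + 8 * b * w ^ 3 - 4 * a * w ^ 2 * (y - 1))"
    unfolding S unfolding E_def step_denom_def by (simp add: algebra_simps eval_nat_numeral)
  also have "9 - y ^ 2 = - ((y - 3) * (y + 3))" by (simp add: algebra_simps power2_eq_square)
  also have "- ((y + 3) * ((y - 1) * (y ^ 2 - 4 * y - 1) + 8 * b * w ^ 3 - 4 * a * w ^ 2 * (y - 1)))
        / (4 * y * w * - ((y - 3) * (y + 3)))
    = ((y - 1) * (y ^ 2 - 4 * y - 1) + 8 * b * w ^ 3 - 4 * a * w ^ 2 * (y - 1)) / (4 * y * w * (y - 3))"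
    using y3 y w by (simp add: divide_simps)
  also have "\<dots> = (y - 1) / (2 * w) - (((y - 1) / (2 * w)) ^ 3 + a * ((y - 1) / (2 * w)) - b) / ((y - 3) / (2 * w) * (y / w))"
    using y3 y w by (simp add: divide_simps) (simp add: algebra_simps eval_nat_numeral)
  finally show ?thesis by (simp add: S_def)
qed

lemma weierstrass_map_cubic_point:
  assumes p: "\<And>x. poly (smult (inverse (lead_coeff p)) p) x = (x - m) ^ 3 + a * (x - m) - b"
    and w: "w \<noteq> 0" and y: "y \<noteq> 0" "y ^ 2 \<noteq> 9" and E: "step_denom a b w y \<noteq> 0"
  shows "weierstrass_map p (cubic_point m w y) = cubic_point m (step_scale a b w y) (- step_shape a b w y)"
proof -
  have U: "UNIV - {1::3} = {2, 3}" "UNIV - {2::3} = {1, 3}" "UNIV - {3::3} = {2, 1}"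
    unfolding UNIV_3 by auto
  define z where "z = cubic_point m w y"
  have z: "z $ 1 - m = 1 / w" "z $ 2 - m = (y - 1) / (2 * w)" "z $ 3 - m = (- y - 1) / (2 * w)"
    by (simp_all add: z_def cubic_point_def add_divide_distrib diff_divide_distrib)
  have d: "z $ 1 - z $ 2 = - ((y - 3) / (2 * w))" "z $ 1 - z $ 3 = (y + 3) / (2 * w)"
    "z $ 2 - z $ 1 = (y - 3) / (2 * w)" "z $ 2 - z $ 3 = y / w"
    "z $ 3 - z $ 1 = (- y - 3) / (2 * w)" "z $ 3 - z $ 2 = (- y) / w"
    using w by (simp_all add: z_def cubic_point_def field_simps)
  have W: "weierstrass_map p z $ k = m + ((z $ k - m)
      - ((z $ k - m) ^ 3 + a * (z $ k - m) - b) / (\<Prod>j\<in>UNIV - {k}. (z $ k - z $ j)))" for k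
    unfolding weierstrass_map_def p by simp
  have "weierstrass_map p z $ 1 = m + 1 / step_scale a b w y"
    unfolding W U using weierstrass_first_coordinate[OF w y(2), of a b] by (simp add: z d)
  moreover have "weierstrass_map p z $ 2 = m + (- step_shape a b w y - 1) / (2 * step_scale a b w y)"
    unfolding W U using weierstrass_second_coordinate[OF w y E] by (simp add: z d)
  \<comment> \<open>By the swap symmetry this is the formula for coordinate 2 at
    \<open>- y\<close>.\<close>
  moreover have "weierstrass_map p z $ 3 = m + (step_shape a b w y - 1) / (2 * step_scale a b w y)"
    unfolding W U using weierstrass_second_coordinate[of w "- y" a b] w y E by (simp add: z d step_minus mult_ac)
  moreover have "(step_shape a b w y - 1) / (2 * step_scale a b w y)
    = - ((- step_shape a b w y + 1) / (2 * step_scale a b w y))"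
    by (simp add: minus_divide_left)
  ultimately show ?thesis
    unfolding z_def[symmetric] vec_eq_iff forall_3 by (simp add: cubic_point_def)
qed

section \<open>Linearisation at the saddle point at infinity\<close>

lemma has_strict_derivative_step_scale:
  assumes "y ^ 2 \<noteq> 5"
  shows "has_strict_derivative (\<lambda>v. step_scale a b (fst v) (y + snd v))
    (\<lambda>v. (9 - y ^ 2) / (5 - y ^ 2) * fst v) 0"
proof -
  \<comment> \<open>The prefactor \<open>w\<close> vanishes at the base point, so the shape
    direction contributes nothing and the multiplier is the value of the cofactor at
    \<open>w = 0\<close>.\<close>
  have "5 - y ^ 2 \<noteq> 0" using assms by simp
  then show ?thesis
    unfolding step_scale_def step_denom_def
    by - (rule has_strict_derivative_eq_rhs, (rule has_strict_derivative_intros)+, simp, rule ext, simp)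
qed

text \<open>The quartic condition is the fixed-point equation of the shape map at
  \<open>w = 0\<close>. The coefficients \<open>a\<close> and \<open>b\<close> enter only with
  \<open>w ^ 2\<close> and \<open>w ^ 3\<close>, hence not in the linear part.\<close>

lemma has_strict_derivative_step_shape:
  assumes "y ^ 2 \<noteq> 5" "y \<noteq> 0" "3 * y ^ 4 - 22 * y ^ 2 + 3 = 0"
  shows "has_strict_derivative (\<lambda>v. step_shape a b (fst v) (y + snd v) - y)
    (\<lambda>v. (10 * y ^ 2 - 34) / (10 - 2 * y ^ 2) * snd v) 0"
proof -
  define E where "E = 5 - y ^ 2"
  have E: "E \<noteq> 0" using assms by (simp add: E_def)
  have N: "y ^ 4 - 12 * y ^ 2 + 3 = y * (2 * y * E)"
    using assms(3) by (simp add: E_def algebra_simps eval_nat_numeral)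
  \<comment> \<open>At a fixed point the numerator is \<open>y\<close> times the denominator
    \<open>D = 2 * y * E\<close>, so the quotient rule collapses to
    \<open>(N' - y * D') / D\<close>.\<close>
  have eq: "((4 * y ^ 3 * h - 24 * (y * h)) * (2 * y * E) - (y ^ 4 - 12 * y ^ 2 + 3) * (2 * y * (- (2 * y * h)) + 2 * h * E))
      / (2 * y * E * (2 * y * E)) = (10 * y ^ 2 - 34) / (10 - 2 * y ^ 2) * h" for h
  proof -
    have "((4 * y ^ 3 * h - 24 * (y * h)) * (2 * y * E) - (y * (2 * y * E)) * (2 * y * (- (2 * y * h)) + 2 * h * E))
      / (2 * y * E * (2 * y * E)) = (4 * y ^ 3 - 24 * y - y * (2 * E - 4 * y ^ 2)) * h / (2 * y * E)"
      using E assms(2) by (simp add: divide_simps) (simp add: algebra_simps eval_nat_numeral)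
    also have "4 * y ^ 3 - 24 * y - y * (2 * E - 4 * y ^ 2) = y * (10 * y ^ 2 - 34)"
      by (simp add: E_def algebra_simps eval_nat_numeral)
    also have "y * (10 * y ^ 2 - 34) * h / (2 * y * E) = (10 * y ^ 2 - 34) / (2 * E) * h"
      using assms(2) by simp
    finally show ?thesis unfolding N by (simp add: E_def algebra_simps)
  qed
  have "has_strict_derivative (\<lambda>v. step_shape a b (fst v) (y + snd v))
    (\<lambda>v. (10 * y ^ 2 - 34) / (10 - 2 * y ^ 2) * snd v) 0"
    unfolding step_shape_def step_denom_def
    apply (rule has_strict_derivative_eq_rhs, (rule has_strict_derivative_intros)+)
    subgoal using assms by simp
    subgoal
      apply (rule ext)
      subgoal for v using eq[of "snd v"] by (simp add: E_def mult_ac)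
      done
    done
  then show ?thesis
    using has_strict_derivative_diff[OF _ has_strict_derivative_const[of y]] by fastforce
qed

text \<open>In \<open>Y = y ^ 2\<close> the fixed-point equation is quadratic, and its larger root
  is taken. Since 7 is the midpoint of 5 and 9, \<open>7 < Y\<close> is what makes
  \<open>(9 - Y) / (5 - Y)\<close> smaller than 1 in modulus.\<close>

lemma saddle_value:
  obtains Y :: real where "7 < Y" "3 * Y ^ 2 - 22 * Y + 3 = 0"
proof
  have "(5/2) ^ 2 < (7::real)" by (simp add: power2_eq_square)
  then have "5/2 < sqrt 7" by (rule real_less_rsqrt)
  then show "7 < (11 + 4 * sqrt 7) / 3" by simp
  show "3 * ((11 + 4 * sqrt 7) / 3) ^ 2 - 22 * ((11 + 4 * sqrt 7) / 3) + 3 = 0"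
    by (simp add: power2_eq_square field_simps)
qed

section \<open>Escape along an invariant curve\<close>

lemma cubic_point_coordinate_bound:
  assumes "norm y \<ge> 3 / 2"
  shows "norm (cubic_point m w y $ k) \<ge> 1 / 4 * inverse (norm w) - norm m"
proof -
  \<comment> \<open>Keeping \<open>y\<close> away from 1 and -1 prevents the last two coordinates
    from staying near \<open>m\<close> while \<open>w\<close> tends to 0.\<close>
  have *: "norm (y - 1) \<ge> 1 / 2" "norm (y + 1) \<ge> 1 / 2"
    using assms norm_triangle_ineq2[of y 1] norm_triangle_ineq2[of y "-1"] by simp_all
  have "\<exists>c. cubic_point m w y $ k - m = c / w \<and> norm c \<ge> 1 / 4"
  proof -
    have "cubic_point m w y $ 1 - m = 1 / w" "cubic_point m w y $ 2 - m = ((y - 1) / 2) / w"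
      "cubic_point m w y $ 3 - m = (- ((y + 1) / 2)) / w"
      by (simp_all add: cubic_point_def)
    moreover have "norm (1::complex) \<ge> 1 / 4" "norm ((y - 1) / 2) \<ge> 1 / 4" "norm (- ((y + 1) / 2)) \<ge> 1 / 4"
      using * by (simp_all add: norm_divide)
    ultimately show ?thesis using exhaust_3[of k] by metis
  qed
  then obtain c where c: "cubic_point m w y $ k - m = c / w" "norm c \<ge> 1 / 4" by blast
  have "1 / 4 * inverse (norm w) \<le> norm c * inverse (norm w)"
    using c(2) by (intro mult_right_mono) auto
  also have "\<dots> = norm (cubic_point m w y $ k - m)"
    unfolding c(1) norm_divide by (rule divide_inverse[symmetric])
  finally show ?thesis using norm_triangle_ineq4[of "cubic_point m w y $ k" m] by linarith
qed

lemma step_holomorphic: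
  assumes \<phi>: "\<phi> holomorphic_on A" and nz: "\<And>w. w \<in> A \<Longrightarrow> step_denom a b w (y + \<phi> w) \<noteq> 0 \<and> y + \<phi> w \<noteq> 0"
  shows "(\<lambda>w. step_scale a b w (y + \<phi> w)) holomorphic_on A"
    and "(\<lambda>w. step_shape a b w (y + \<phi> w)) holomorphic_on A"
proof -
  have "(\<lambda>w. step_denom a b w (y + \<phi> w)) holomorphic_on A"
    unfolding step_denom_def by (intro holomorphic_intros \<phi>)
  then show "(\<lambda>w. step_scale a b w (y + \<phi> w)) holomorphic_on A"
    "(\<lambda>w. step_shape a b w (y + \<phi> w)) holomorphic_on A"
    unfolding step_scale_def step_shape_def
    using nz by (intro holomorphic_intros \<phi>; simp del: distrib_left_numeral)+
qed

text \<open>The curve \<open>y = Y w\<close> is invariant up to the swap of the last two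
  coordinates, and \<open>w\<close> shrinks geometrically along it. Hence every coordinate grows at
  least like a multiple of the inverse of \<open>norm w\<close>.\<close>

lemma escaping_points_on_invariant_curve:
  assumes p: "\<And>x. poly (smult (inverse (lead_coeff p)) p) x = (x - m) ^ 3 + a * (x - m) - b"
    and q: "0 \<le> q" "q < 1"
    and nz: "\<And>w. w \<in> ball 0 r \<Longrightarrow>
        step_denom a b w (Y w) \<noteq> 0 \<and> (Y w) ^ 2 \<noteq> 9 \<and> norm (Y w) \<ge> 3 / 2"
    and scale: "\<And>w. w \<in> ball 0 r \<Longrightarrow> norm (step_scale a b w (Y w)) \<le> q * norm w"
    and shape: "\<And>w. w \<in> ball 0 r \<Longrightarrow> step_shape a b w (Y w) = Y (step_scale a b w (Y w))"
    and w: "w \<in> ball 0 r" "w \<noteq> 0"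
  shows "cubic_point m w (Y w) \<in> escaping_set p"
proof -
  define F where "F w = step_scale a b w (Y w)" for w
  define u where "u n = (F ^^ n) w" for n
  have u_Suc: "u (Suc n) = F (u n)" for n by (simp add: u_def)
  have u: "u n \<in> ball 0 r" "u n \<noteq> 0" "norm (u n) \<le> q ^ n * norm w" for n
  proof (induction n)
    case 0
    show "u 0 \<in> ball 0 r" "u 0 \<noteq> 0" "norm (u 0) \<le> q ^ 0 * norm w" using w by (simp_all add: u_def)
  next
    case (Suc n)
    have F: "norm (F (u n)) \<le> q * norm (u n)" using scale[OF Suc(1)] by (simp add: F_def)
    moreover have "q * norm (u n) \<le> 1 * norm (u n)" using q by (intro mult_right_mono) auto
    ultimately show "u (Suc n) \<in> ball 0 r" using Suc(1) by (simp add: u_Suc)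
    have "q * norm (u n) \<le> q * (q ^ n * norm w)" using q Suc(3) by (intro mult_left_mono)
    with F show "norm (u (Suc n)) \<le> q ^ Suc n * norm w" by (simp add: u_Suc mult.assoc)
    \<comment> \<open>The orbit never lands on the point at infinity: none of the factors
      \<open>w\<close>, \<open>9 - y ^ 2\<close> and the denominator vanishes.\<close>
    show "u (Suc n) \<noteq> 0"
      using nz[OF Suc(1)] Suc(2) by (simp add: u_Suc F_def step_scale_def)
  qed
  \<comment> \<open>The sign of the shape alternates from step to step; the two-element set avoids
    tracking parity.\<close>
  have orbit: "(weierstrass_map p ^^ n) (cubic_point m w (Y w)) \<in> {cubic_point m (u n) (Y (u n)), cubic_point m (u n) (- Y (u n))}" for n
  proof (induction n)
    case 0
    show ?case by (simp add: u_def)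
  next
    case (Suc n)
    have "weierstrass_map p (cubic_point m (u n) (s * Y (u n)))
        = cubic_point m (u (Suc n)) (- s * Y (u (Suc n)))"
      if s: "s = 1 \<or> s = -1" for s
    proof -
      have "weierstrass_map p (cubic_point m (u n) (s * Y (u n)))
        = cubic_point m (step_scale a b (u n) (s * Y (u n))) (- step_shape a b (u n) (s * Y (u n)))"
        using nz[OF u(1)[of n]] u(2)[of n] s
        by (intro weierstrass_map_cubic_point p) (auto simp: step_minus)
      then show ?thesis
        using s shape[OF u(1)[of n]] by (auto simp: step_minus u_Suc F_def)
    qed
    from this[of 1] this[of "-1"] Suc.IH show ?case by auto
  qed
  have Y_nz: "Y (u n) \<noteq> 0" for n using nz[OF u(1)[of n]] by auto
  have "off_diagonal ((weierstrass_map p ^^ n) (cubic_point m w (Y w)))" for n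
    using orbit[of n] off_diagonal_cubic_point[of "u n" "Y (u n)" m] off_diagonal_cubic_point[of "u n" "- Y (u n)" m]
      u(2)[of n] nz[OF u(1)[of n]] Y_nz[of n] by auto
  then have "iterates_defined p (cubic_point m w (Y w))" by (simp add: iterates_defined_def)
  moreover have "filterlim (\<lambda>n. norm ((weierstrass_map p ^^ n) (cubic_point m w (Y w)) $ k)) at_top sequentially" for k
  proof (rule filterlim_at_top_mono)
    have "(\<lambda>n. q ^ n * norm w) \<longlonglongrightarrow> 0 * norm w"
      using q by (intro tendsto_mult LIMSEQ_realpow_zero tendsto_const)
    then have "(\<lambda>n. norm (u n)) \<longlonglongrightarrow> 0"
      using u(3) by (intro Lim_null_comparison[where g = "\<lambda>n. q ^ n * norm w" and f = "\<lambda>n. norm (u n)"]) auto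
    then have "filterlim (\<lambda>n. inverse (norm (u n))) at_top sequentially"
      using u(2) by (intro filterlim_inverse_at_top) auto
    then have "filterlim (\<lambda>n. 1 / 4 * inverse (norm (u n))) at_top sequentially"
      by (intro filterlim_tendsto_pos_mult_at_top[OF tendsto_const]) auto
    then show "filterlim (\<lambda>n. - norm m + 1 / 4 * inverse (norm (u n))) at_top sequentially"
      by (intro filterlim_tendsto_add_at_top[OF tendsto_const])
    show "\<forall>\<^sub>F n in sequentially. - norm m + 1 / 4 * inverse (norm (u n))
        \<le> norm ((weierstrass_map p ^^ n) (cubic_point m w (Y w)) $ k)"
    proof (rule always_eventually, rule allI)
      fix n
      show "- norm m + 1 / 4 * inverse (norm (u n)) \<le> norm ((weierstrass_map p ^^ n) (cubic_point m w (Y w)) $ k)"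
        using orbit[of n] nz[OF u(1)[of n]] cubic_point_coordinate_bound[of "Y (u n)" "u n" m k]
          cubic_point_coordinate_bound[of "- Y (u n)" "u n" m k] by auto
    qed
  qed
  ultimately show ?thesis by (simp add: escaping_set_def)
qed

section \<open>The escaping curve for an arbitrary cubic\<close>

theorem theorem3p9:
  fixes p :: "complex poly"
  assumes "degree p = 3"
  shows "escaping_set p \<noteq> ({} :: (complex^3) set)
         \<and> (\<exists>U (\<gamma> :: complex \<Rightarrow> complex^3).
               open U \<and> connected U \<and> U \<noteq> {}
             \<and> (\<forall>k. (\<lambda>t. \<gamma> t $ k) holomorphic_on U)
             \<and> \<not> (\<exists>c. \<forall>t\<in>U. \<gamma> t = c)
             \<and> \<gamma> ` U \<subseteq> escaping_set p)"
proof -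
  obtain m a b where p: "\<And>x. poly (smult (inverse (lead_coeff p)) p) x = (x - m) ^ 3 + a * (x - m) - b"
    using monic_cubic_depressed[OF assms] by blast
  obtain Y :: real where Y: "7 < Y" "3 * Y ^ 2 - 22 * Y + 3 = 0"
    using saddle_value by blast
  define y where "y = complex_of_real (sqrt Y)"
  have y2: "y ^ 2 = of_real Y" using Y by (simp add: y_def flip: of_real_power)
  have "3 * y ^ 4 - 22 * y ^ 2 + 3 = 3 * (y ^ 2) ^ 2 - 22 * y ^ 2 + 3" by (simp flip: power_mult)
  also have "\<dots> = of_real (3 * Y ^ 2 - 22 * Y + 3)" unfolding y2 by simp
  finally have y4: "3 * y ^ 4 - 22 * y ^ 2 + 3 = 0" using Y by simp
  have "Y \<noteq> 5" "Y \<noteq> 9" using Y by (auto simp: power2_eq_square)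
  then have y5: "y ^ 2 \<noteq> 5" and y9: "y ^ 2 \<noteq> 9"
    unfolding y2 using of_real_eq_iff[of Y 5] of_real_eq_iff[of Y 9] by auto
  \<comment> \<open>With norm at least 5/2, perturbing \<open>y\<close> by less than 1 leaves the
    3/2 required for the coordinate bound.\<close>
  have "(5 / 2) ^ 2 \<le> Y" using Y by (simp add: power2_eq_square)
  then have "5 / 2 \<le> sqrt Y" by (rule real_le_rsqrt)
  then have y_norm: "norm y \<ge> 5 / 2" by (simp add: y_def)
  define \<nu> where "\<nu> = (9 - y ^ 2) / (5 - y ^ 2)"
  define \<mu> where "\<mu> = (10 * y ^ 2 - 34) / (10 - 2 * y ^ 2)"
  have "\<nu> = of_real ((9 - Y) / (5 - Y))" "\<mu> = of_real ((10 * Y - 34) / (10 - 2 * Y))"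
    unfolding \<nu>_def \<mu>_def y2 by simp_all
  moreover have "\<bar>(9 - Y) / (5 - Y)\<bar> < 1" "\<bar>(10 * Y - 34) / (10 - 2 * Y)\<bar> > 1"
    using Y(1) by (auto simp: abs_divide divide_simps abs_if)
  ultimately have eig: "norm \<nu> < 1" "norm \<mu> > 1" by (simp_all only: norm_of_real)

  \<comment> \<open>One continuous function whose nonvanishing excludes both a zero denominator and
    the collisions \<open>y ^ 2 = 9\<close>.\<close>
  define K where "K v = step_denom a b (fst v) (y + snd v) * ((y + snd v) ^ 2 - 9)" for v
  have "continuous (at 0) K"
    unfolding K_def step_denom_def by (intro continuous_intros)
  moreover have "K 0 \<noteq> 0" using y5 y9 by (simp add: K_def step_denom_def)
  ultimately obtain d where d: "d > 0" "\<And>v. dist 0 v < d \<Longrightarrow> K v \<noteq> 0"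
    using continuous_at_avoid by blast
  define R where "R = min 1 (d / 2)"
  have R: "R > 0" "R \<le> 1" "R \<le> d / 2" using d by (auto simp: R_def)
  have nz: "step_denom a b w (y + x) \<noteq> 0 \<and> (y + x) ^ 2 \<noteq> 9 \<and> norm (y + x) \<ge> 3 / 2"
    if "norm w < R" "norm x < R" for w x
  proof -
    have "dist 0 (w, x) < d"
      using norm_Pair_le[of w x] that R by simp
    from d(2)[OF this] show ?thesis
      using norm_diff_ineq[of y x] that R y_norm by (simp add: K_def)
  qed
  have nz': "step_denom a b w (y + \<phi> w) \<noteq> 0 \<and> (y + \<phi> w) ^ 2 \<noteq> 9 \<and> norm (y + \<phi> w) \<ge> 3 / 2"
    if "r \<le> R" "\<And>w. w \<in> ball 0 r \<Longrightarrow> norm (\<phi> w) \<le> norm w" "w \<in> ball 0 r" for r \<phi> w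
    using that(2)[OF that(3)] that(1,3) by (intro nz) auto
  have hol: "(\<lambda>w. step_scale a b w (y + \<phi> w)) holomorphic_on ball 0 r"
      "(\<lambda>w. step_shape a b w (y + \<phi> w)) holomorphic_on ball 0 r"
    if "r \<le> R" "\<phi> holomorphic_on ball 0 r" "\<And>w. w \<in> ball 0 r \<Longrightarrow> norm (\<phi> w) \<le> norm w" for r \<phi>
    using nz'[OF that(1,3)] by (intro step_holomorphic that(2); fastforce)+
  have y0: "y \<noteq> 0" using y_norm by auto
  \<comment> \<open>Coordinates centred at the saddle: the second variable is the deviation of the
    shape from \<open>y\<close>. The map \<open>(G, H)\<close> already includes the swap, which
    makes the saddle a fixed point.\<close>
  define G where "G v = step_scale a b (fst v) (y + snd v)" for v
  define H where "H v = step_shape a b (fst v) (y + snd v) - y" for v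
  have G: "has_strict_derivative G (\<lambda>v. \<nu> * fst v) 0"
    unfolding G_def \<nu>_def using has_strict_derivative_step_scale[OF y5] .
  have H: "has_strict_derivative H (\<lambda>v. \<mu> * snd v) 0"
    unfolding H_def \<mu>_def using has_strict_derivative_step_shape[OF y5 y0 y4] .
  have G0: "G 0 = 0" by (simp add: G_def step_scale_def)
  have "y ^ 4 - 12 * y ^ 2 + 3 = y * (2 * y * (5 - y ^ 2))"
    using y4 by (simp add: algebra_simps eval_nat_numeral)
  then have H0: "H 0 = 0"
    using y0 y5 by (simp add: H_def step_shape_def step_denom_def)
  have holGH: "(\<lambda>w. G (w, \<psi> w)) holomorphic_on ball 0 s" "(\<lambda>w. H (w, \<psi> w)) holomorphic_on ball 0 s"
    if "s \<le> R" "\<psi> holomorphic_on ball 0 s" "\<And>w. w \<in> ball 0 s \<Longrightarrow> norm (\<psi> w) \<le> norm w" for s \<psi>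
    using hol[OF that] by (auto simp: G_def H_def intro!: holomorphic_intros)
  obtain r q \<phi> where r: "0 < r" "r \<le> R" and q: "0 \<le> q" "q < 1"
    and \<phi>: "\<phi> holomorphic_on ball 0 r" and bound: "\<And>w. w \<in> ball 0 r \<Longrightarrow> norm (\<phi> w) \<le> norm w"
    and scale: "\<And>w. w \<in> ball 0 r \<Longrightarrow> norm (G (w, \<phi> w)) \<le> q * norm w"
    and shape: "\<And>w. w \<in> ball 0 r \<Longrightarrow> H (w, \<phi> w) = \<phi> (G (w, \<phi> w))"
    by (rule holomorphic_stable_manifold[OF G G0 H H0 eig R(1)]) (assumption | rule holGH | rule that)+
  define \<gamma> where "\<gamma> w = cubic_point m w (y + \<phi> w)" for w
  \<comment> \<open>A disc inside \<open>ball 0 r\<close> with 0 on its boundary: connected, and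
    free of the value \<open>w = 0\<close> that stands for infinity.\<close>
  define U where "U = ball (complex_of_real (r / 2)) (r / 2)"
  have U: "w \<in> ball 0 r \<and> w \<noteq> 0" if "w \<in> U" for w
  proof -
    have "norm (complex_of_real (r / 2)) = r / 2" using r by simp
    then show ?thesis
      using that norm_triangle_sub[of w "complex_of_real (r / 2)"]
      by (auto simp: U_def dist_norm norm_minus_commute)
  qed
  have esc: "\<gamma> w \<in> escaping_set p" if "w \<in> U" for w
    unfolding \<gamma>_def
  proof (rule escaping_points_on_invariant_curve[OF p q, where Y = "\<lambda>w. y + \<phi> w" and r = r])
    show "w \<in> ball 0 r" "w \<noteq> 0" using U that by auto
    fix u :: complex assume u: "u \<in> ball 0 r"
    show "step_denom a b u (y + \<phi> u) \<noteq> 0 \<and> (y + \<phi> u) ^ 2 \<noteq> 9 \<and> norm (y + \<phi> u) \<ge> 3 / 2"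
      using nz'[OF r(2) bound u] .
    show "norm (step_scale a b u (y + \<phi> u)) \<le> q * norm u"
      using scale[OF u] by (simp add: G_def)
    show "step_shape a b u (y + \<phi> u) = y + \<phi> (step_scale a b u (y + \<phi> u))"
      using shape[OF u] by (simp add: G_def H_def algebra_simps)
  qed
  have points: "complex_of_real (r / 2) \<in> U" "complex_of_real (3 * r / 4) \<in> U"
  proof -
    show "complex_of_real (r / 2) \<in> U" using r by (simp add: U_def)
    have "complex_of_real (r / 2) - complex_of_real (3 * r / 4) = complex_of_real (- (r / 4))"
      by (simp flip: of_real_diff)
    then show "complex_of_real (3 * r / 4) \<in> U"
      using r unfolding U_def mem_ball dist_norm by (simp only: norm_of_real)
  qed
  have "complex_of_real (r / 2) \<noteq> complex_of_real (3 * r / 4)"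
    using r by (simp only: of_real_eq_iff)
  \<comment> \<open>The first coordinate \<open>m + 1 / w\<close> determines \<open>w\<close>, so
    the curve is injective and in particular not constant.\<close>
  moreover have "s = t" if "\<gamma> s = \<gamma> t" for s t
    using arg_cong[OF that, of "\<lambda>z. vec_nth z 1"] by (simp add: \<gamma>_def cubic_point_def)
  ultimately have "\<not> (\<exists>c. \<forall>t\<in>U. \<gamma> t = c)" using points by metis
  moreover have "(\<lambda>t. \<gamma> t $ k) holomorphic_on U" for k
  proof -
    have "\<phi> holomorphic_on U" using \<phi> U by (auto intro: holomorphic_on_subset)
    then have "(\<lambda>t. \<gamma> t $ 1) holomorphic_on U" "(\<lambda>t. \<gamma> t $ 2) holomorphic_on U" "(\<lambda>t. \<gamma> t $ 3) holomorphic_on U"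
      unfolding \<gamma>_def cubic_point_def vector_3 using U by (auto intro!: holomorphic_intros)
    then show ?thesis using exhaust_3[of k] by metis
  qed
  moreover have "open U" "connected U" "U \<noteq> {}" using points by (auto simp: U_def)
  moreover have "\<gamma> ` U \<subseteq> escaping_set p" using esc by blast
  ultimately show ?thesis using points by blast
qed

end
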